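(* Let $G$ and $H$ be graphs and let $p$ be a positive integer. Then $$(G\boxtimes H)^{[\natural p]}=\biguplus_{i=0}^{p} \left((G^{[\natural p]}\times H^{[\natural i]})\uplus (G^{[\natural i]}\times H^{[\natural p]})\right)\,.$$
   Context: For a graph $G$ and a positive integer $p$, the exact distance-$p$ graph $G^{[\natural p]}$ has vertex set $V(G)$, two vertices being adjacent iff their distance in $G$ equals exactly $p$. $G^{[\natural 0]}$ is the graph on $V(G)$ with a loop at each vertex and no other edges. If $G$ and $H$ are graphs on the same vertex set, $G\uplus H$ is the graph on that vertex set with edge set $E(G)\cup E(H)$ ($\biguplus$ is the iterated version). All products have vertex set $V(G)\times V(H)$. In the strong product $G\boxtimes H$, distinct vertices $(g_1,h_1),(g_2,h_2)$ are adjacent iff either $g_1g_2\in E(G)$ and $h_1=h_2$, or $g_1=g_2$ and $h_1h_2\in E(H)$, or $g_1g_2\in E(G)$ and $h_1h_2\in E(H)$. In the direct product $G\times H$, $(g_1,h_1)(g_2,h_2)$ is an edge iff $g_1g_2\in E(G)$ and $h_1h_2\in E(H)$ (where a loop at $g$ counts as $gg\in E(G)$). Equalities are equalities of graphs on $V(G)\times V(H)$. *)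

theory Defs
  imports "Graph_Theory.Pair_Digraph" "Graph_Theory.Shortest_Path"
begin

text \<open>
  An undirected graph, possibly with loops but without parallel edges, is a
  \<^term>\<open>pair_sym_digraph\<close>: each edge is represented by both of its orientations.
  The distance is infinite between vertices in different components.
\<close>

definition graph_dist :: "'a pair_pre_digraph \<Rightarrow> 'a \<Rightarrow> 'a \<Rightarrow> ereal" where
  "graph_dist G u v = wf_digraph.\<mu> (with_proj G) (\<lambda>_. 1) u v"

definition exact_dist_graph :: "'a pair_pre_digraph \<Rightarrow> nat \<Rightarrow> 'a pair_pre_digraph"
    ("_\<^bsup>[\<natural>_]\<^esup>" [1000, 0] 1000) where
  "G\<^bsup>[\<natural>p]\<^esup> = \<lparr> pverts = pverts G,
     parcs = (if p = 0 then {(v, v) | v. v \<in> pverts G}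
              else {(u, v). u \<in> pverts G \<and> v \<in> pverts G \<and> graph_dist G u v = ereal (real p)}) \<rparr>"

text \<open>The edge union is only meant for graphs on the same vertex set.\<close>

definition edge_union :: "'a pair_pre_digraph \<Rightarrow> 'a pair_pre_digraph \<Rightarrow> 'a pair_pre_digraph"
    (infixl "\<uplus>" 65) where
  "G \<uplus> H = \<lparr> pverts = pverts G \<union> pverts H, parcs = parcs G \<union> parcs H \<rparr>"

text \<open>\<open>Edge_union F n\<close> is the iterated union \<open>F 0 \<uplus> F 1 \<uplus> \<dots> \<uplus> F n\<close>, including index \<open>n\<close>.\<close>

primrec Edge_union :: "(nat \<Rightarrow> 'a pair_pre_digraph) \<Rightarrow> nat \<Rightarrow> 'a pair_pre_digraph" where
  "Edge_union F 0 = F 0"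
| "Edge_union F (Suc n) = Edge_union F n \<uplus> F (Suc n)"

definition strong_prod ::
    "'a pair_pre_digraph \<Rightarrow> 'b pair_pre_digraph \<Rightarrow> ('a \<times> 'b) pair_pre_digraph"
    (infixl "\<boxtimes>" 70) where
  "G \<boxtimes> H = \<lparr> pverts = pverts G \<times> pverts H,
     parcs = {((g\<^sub>1, h\<^sub>1), (g\<^sub>2, h\<^sub>2)) | g\<^sub>1 h\<^sub>1 g\<^sub>2 h\<^sub>2.
       (g\<^sub>1, h\<^sub>1) \<in> pverts G \<times> pverts H \<and> (g\<^sub>2, h\<^sub>2) \<in> pverts G \<times> pverts H \<and>
       (g\<^sub>1, h\<^sub>1) \<noteq> (g\<^sub>2, h\<^sub>2) \<and>
       ((g\<^sub>1, g\<^sub>2) \<in> parcs G \<and> h\<^sub>1 = h\<^sub>2 \<or>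
        g\<^sub>1 = g\<^sub>2 \<and> (h\<^sub>1, h\<^sub>2) \<in> parcs H \<or>
        (g\<^sub>1, g\<^sub>2) \<in> parcs G \<and> (h\<^sub>1, h\<^sub>2) \<in> parcs H)} \<rparr>"

definition direct_prod ::
    "'a pair_pre_digraph \<Rightarrow> 'b pair_pre_digraph \<Rightarrow> ('a \<times> 'b) pair_pre_digraph"
    (infixl "\<times>\<^sub>G" 70) where
  "G \<times>\<^sub>G H = \<lparr> pverts = pverts G \<times> pverts H,
     parcs = {((g\<^sub>1, h\<^sub>1), (g\<^sub>2, h\<^sub>2)) | g\<^sub>1 h\<^sub>1 g\<^sub>2 h\<^sub>2.
       (g\<^sub>1, g\<^sub>2) \<in> parcs G \<and> (h\<^sub>1, h\<^sub>2) \<in> parcs H} \<rparr>"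

end

theory Submission
  imports Defs
begin

text \<open>
  Adding a loop at every vertex turns the strong product into the direct product, and a walk of
  length at most \<open>n\<close> becomes a walk of length exactly \<open>n\<close>.  Such walks in a direct product are pairs
  of walks of the same length in the factors, so the distance in \<open>G \<boxtimes> H\<close> is the maximum of the
  distances in \<open>G\<close> and \<open>H\<close>.  This maximum equals \<open>p\<close> iff one of the distances is \<open>p\<close> and the other
  is some \<open>i \<le> p\<close>.
\<close>

text \<open>A bare relation suffices: its power \<open>^^ n\<close> collects the pairs joined by a
  lazy walk of exactly \<open>n\<close> steps.\<close>

definition lazy_arcs :: "'a pair_pre_digraph \<Rightarrow> 'a rel" where
  "lazy_arcs G = parcs G \<union> Id_on (pverts G)"

context pair_wf_digraph
begin

lemma awalk_cost_one: "awalk_cost (\<lambda>_. 1) p = real (length p)"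
  by (induct p) auto

lemma graph_dist_eq_INF: "graph_dist G u v = (INF p\<in>{p. awalk u p v}. ereal (real (length p)))"
  unfolding graph_dist_def \<mu>_def by (simp add: awalk_cost_one)

lemma graph_dist_le_iff_awalk:
  "graph_dist G u v \<le> ereal (real n) \<longleftrightarrow> (\<exists>p. awalk u p v \<and> length p \<le> n)"
proof
  assume "graph_dist G u v \<le> ereal (real n)"
  \<comment> \<open>A strict bound on an infimum yields a witness at once, and a length below
    \<open>Suc n\<close> is at most \<open>n\<close>.\<close>
  also have "\<dots> < ereal (real (Suc n))" by simp
  finally show "\<exists>p. awalk u p v \<and> length p \<le> n"
    unfolding graph_dist_eq_INF INF_less_iff by auto
next
  assume "\<exists>p. awalk u p v \<and> length p \<le> n"
  then show "graph_dist G u v \<le> ereal (real n)"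
    unfolding graph_dist_eq_INF by (auto intro: INF_lower2)
qed

text \<open>Walk lengths are naturals, so the infimum is attained if some walk exists; over the
  empty set it is \<open>\<infinity>\<close>.\<close>

lemma graph_dist_cases:
  obtains n :: nat where "graph_dist G u v = ereal (real n)" | "graph_dist G u v = \<infinity>"
proof (cases "\<exists>p. awalk u p v")
  case True
  then obtain p where p: "awalk u p v" "\<And>q. awalk u q v \<Longrightarrow> length p \<le> length q"
    using ex_has_least_nat[of "\<lambda>p. awalk u p v" _ length] by blast
  then have "graph_dist G u v = ereal (real (length p))"
    unfolding graph_dist_eq_INF by (intro INF_eqI) auto
  then show ?thesis by (rule that)
next
  case False
  then show ?thesis
    using that(2) by (simp add: graph_dist_eq_INF top_ereal_def)
qed

lemma relpow_lazy_arcs_if_awalk: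
  "awalk u p v \<Longrightarrow> length p \<le> n \<Longrightarrow> (u, v) \<in> lazy_arcs G ^^ n"
proof (induct n arbitrary: u p)
  case 0
  then show ?case by (simp add: awalk_Nil_iff)
next
  case (Suc n)
  show ?case
  proof (cases p)
    \<comment> \<open>The walk is used up early, so the remaining steps are loops at
      \<open>u\<close>.\<close>
    case Nil
    then have "(u, u) \<in> lazy_arcs G" "(u, v) \<in> lazy_arcs G ^^ n"
      using Suc.prems Suc.hyps[of u p] by (auto simp: lazy_arcs_def awalk_Nil_iff)
    then show ?thesis by (rule relpow_Suc_I2)
  next
    case (Cons e es)
    then have "(u, snd e) \<in> lazy_arcs G" "(snd e, v) \<in> lazy_arcs G ^^ n"
      using Suc.prems Suc.hyps[of "snd e" es] by (auto simp: lazy_arcs_def awalk_Cons_iff)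
    then show ?thesis by (rule relpow_Suc_I2)
  qed
qed

text \<open>Dropping the loop steps leaves a walk. The power \<open>^^ 0\<close> is the identity on
  the whole type, whereas an empty walk must start at a vertex; hence the premise on
  \<open>u\<close>.\<close>

lemma awalk_if_relpow_lazy_arcs:
  "(u, v) \<in> lazy_arcs G ^^ n \<Longrightarrow> u \<in> pverts G \<Longrightarrow> \<exists>p. awalk u p v \<and> length p \<le> n"
proof (induct n arbitrary: u)
  case 0
  then show ?case by (auto simp: awalk_Nil_iff)
next
  case (Suc n)
  then obtain w where w: "(u, w) \<in> lazy_arcs G" "(w, v) \<in> lazy_arcs G ^^ n"
    by (blast dest: relpow_Suc_D2)
  then have "w \<in> pverts G"
    using arc_snd_in_verts[of "(u, w)"] by (auto simp: lazy_arcs_def)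
  then obtain p where p: "awalk w p v" "length p \<le> n"
    using Suc.hyps w by blast
  from w(1) consider "w = u" | "(u, w) \<in> parcs G"
    by (auto simp: lazy_arcs_def)
  then show ?case
  proof cases
    case 1
    then show ?thesis using p by (meson le_SucI)
  next
    case 2
    then have "awalk u ((u, w) # p) v" using p by (simp add: awalk_Cons_iff)
    then show ?thesis using p by (intro exI[of _ "(u, w) # p"]) simp
  qed
qed

lemma graph_dist_le_iff_relpow:
  assumes "u \<in> pverts G"
  shows "graph_dist G u v \<le> ereal (real n) \<longleftrightarrow> (u, v) \<in> lazy_arcs G ^^ n"
  using assms awalk_if_relpow_lazy_arcs relpow_lazy_arcs_if_awalk
  unfolding graph_dist_le_iff_awalk by blast

text \<open>The separately defined loops at index 0 are exactly the pairs at distance 0, so the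
  index \<open>i = 0\<close> of the union needs no special treatment later.\<close>

lemma arcs_exact_dist_graph:
  "(u, v) \<in> parcs (G\<^bsup>[\<natural>n]\<^esup>) \<longleftrightarrow>
    u \<in> pverts G \<and> v \<in> pverts G \<and> graph_dist G u v = ereal (real n)"
proof (cases "n = 0")
  case True
  have "graph_dist G u v = 0 \<longleftrightarrow> graph_dist G u v \<le> ereal (real 0)"
    by (rule graph_dist_cases[of u v]) auto
  then show ?thesis
    using True graph_dist_le_iff_relpow[of u v 0] by (auto simp: exact_dist_graph_def)
qed (simp add: exact_dist_graph_def)

end

lemma pverts_strong_prod: "pverts (G \<boxtimes> H) = pverts G \<times> pverts H"
  by (simp add: strong_prod_def)

lemma pair_wf_digraph_strong_prod: "pair_wf_digraph (G \<boxtimes> H)"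
  by unfold_locales (auto simp: strong_prod_def)

text \<open>Each coordinate either moves along an arc or stays. The combinations with a move are the
  three clauses of \<open>strong_prod\<close>; staying in both is the added loop, which also covers
  pairs of loops in the factors.\<close>

lemma lazy_arcs_strong_prod:
  assumes "pair_wf_digraph G" "pair_wf_digraph H"
  shows "((g, h), (g', h')) \<in> lazy_arcs (G \<boxtimes> H) \<longleftrightarrow>
    (g, g') \<in> lazy_arcs G \<and> (h, h') \<in> lazy_arcs H"
  using pair_wf_digraph.arc_fst_in_verts[OF assms(1), of "(g, g')"]
    pair_wf_digraph.arc_snd_in_verts[OF assms(1), of "(g, g')"]
    pair_wf_digraph.arc_fst_in_verts[OF assms(2), of "(h, h')"]
    pair_wf_digraph.arc_snd_in_verts[OF assms(2), of "(h, h')"]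
  by (auto simp: lazy_arcs_def strong_prod_def)

lemma relpow_lazy_arcs_strong_prod:
  assumes "pair_wf_digraph G" "pair_wf_digraph H"
  shows "((g, h), (g', h')) \<in> lazy_arcs (G \<boxtimes> H) ^^ n \<longleftrightarrow>
    (g, g') \<in> lazy_arcs G ^^ n \<and> (h, h') \<in> lazy_arcs H ^^ n"
proof (induct n arbitrary: g' h')
  case (Suc n)
  then show ?case
    by (auto simp: relcomp_unfold lazy_arcs_strong_prod[OF assms])
qed auto

theorem graph_dist_strong_prod:
  assumes "pair_wf_digraph G" "pair_wf_digraph H" "g \<in> pverts G" "h \<in> pverts H"
  shows "graph_dist (G \<boxtimes> H) (g, h) (g', h') = max (graph_dist G g g') (graph_dist H h h')"
proof -
  interpret G: pair_wf_digraph G by fact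
  interpret H: pair_wf_digraph H by fact
  interpret P: pair_wf_digraph "G \<boxtimes> H" by (rule pair_wf_digraph_strong_prod)
  let ?d = "graph_dist (G \<boxtimes> H) (g, h) (g', h')"
  let ?m = "max (graph_dist G g g') (graph_dist H h h')"
  have "(g, h) \<in> pverts (G \<boxtimes> H)" using assms by (simp add: pverts_strong_prod)
  \<comment> \<open>Both sides have the same natural upper bounds; as each is a natural or
    \<open>\<infinity>\<close>, this forces equality.\<close>
  then have le_iff: "?d \<le> ereal (real n) \<longleftrightarrow> ?m \<le> ereal (real n)" for n
    using assms by (simp add: P.graph_dist_le_iff_relpow G.graph_dist_le_iff_relpow
        H.graph_dist_le_iff_relpow relpow_lazy_arcs_strong_prod)
  have "(\<exists>k. ?m = ereal (real k)) \<or> ?m = \<infinity>"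
    by (rule G.graph_dist_cases[of g g']; rule H.graph_dist_cases[of h h'])
      (auto simp: max_def)
  moreover have "(\<exists>k. ?d = ereal (real k)) \<or> ?d = \<infinity>"
    by (rule P.graph_dist_cases) auto
  ultimately show ?thesis
    using le_iff by (metis antisym ereal_infty_less_eq(1) order_refl)
qed

lemma pverts_Edge_union: "pverts (Edge_union F n) = (\<Union>i\<le>n. pverts (F i))"
  by (induct n) (auto simp: edge_union_def atMost_Suc)

lemma parcs_Edge_union: "parcs (Edge_union F n) = (\<Union>i\<le>n. parcs (F i))"
  by (induct n) (auto simp: edge_union_def atMost_Suc)

theorem theorem2p3:
  fixes G :: "'a pair_pre_digraph" and H :: "'b pair_pre_digraph" and p :: nat
  assumes "pair_sym_digraph G" and "pair_sym_digraph H" and "p > 0"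
  shows "(G \<boxtimes> H)\<^bsup>[\<natural>p]\<^esup> =
    Edge_union (\<lambda>i. (G\<^bsup>[\<natural>p]\<^esup> \<times>\<^sub>G H\<^bsup>[\<natural>i]\<^esup>) \<uplus> (G\<^bsup>[\<natural>i]\<^esup> \<times>\<^sub>G H\<^bsup>[\<natural>p]\<^esup>)) p"
proof -
  let ?L = "(G \<boxtimes> H)\<^bsup>[\<natural>p]\<^esup>"
  let ?R = "Edge_union (\<lambda>i. (G\<^bsup>[\<natural>p]\<^esup> \<times>\<^sub>G H\<^bsup>[\<natural>i]\<^esup>) \<uplus> (G\<^bsup>[\<natural>i]\<^esup> \<times>\<^sub>G H\<^bsup>[\<natural>p]\<^esup>)) p"
  interpret G: pair_sym_digraph G by fact
  interpret H: pair_sym_digraph H by fact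
  interpret P: pair_wf_digraph "G \<boxtimes> H" by (rule pair_wf_digraph_strong_prod)
  have wf: "pair_wf_digraph G" "pair_wf_digraph H" by unfold_locales
  have arcs_R: "((g, h), (g', h')) \<in> parcs ?R \<longleftrightarrow> (\<exists>i\<le>p.
      (g, g') \<in> parcs (G\<^bsup>[\<natural>p]\<^esup>) \<and> (h, h') \<in> parcs (H\<^bsup>[\<natural>i]\<^esup>) \<or>
      (g, g') \<in> parcs (G\<^bsup>[\<natural>i]\<^esup>) \<and> (h, h') \<in> parcs (H\<^bsup>[\<natural>p]\<^esup>))" for g h g' h'
    by (auto simp: parcs_Edge_union edge_union_def direct_prod_def)
  \<comment> \<open>The index \<open>i\<close> is the smaller of the two distances; an infinite
    distance would make the maximum infinite.\<close>
  have max_eq_iff: "max (graph_dist G g g') (graph_dist H h h') = ereal (real p) \<longleftrightarrow> (\<exists>i\<le>p.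
      graph_dist G g g' = ereal (real p) \<and> graph_dist H h h' = ereal (real i) \<or>
      graph_dist G g g' = ereal (real i) \<and> graph_dist H h h' = ereal (real p))" for g h g' h'
    by (rule G.graph_dist_cases[of g g']; rule H.graph_dist_cases[of h h'])
      (auto simp: max_def)
  have "((g, h), (g', h')) \<in> parcs ?L \<longleftrightarrow> ((g, h), (g', h')) \<in> parcs ?R" for g h g' h'
  \<comment> \<open>The distance formula requires \<open>g\<close> and \<open>h\<close> to be
    vertices; otherwise neither side has an arc starting at \<open>(g, h)\<close>.\<close>
  proof (cases "g \<in> pverts G \<and> h \<in> pverts H")
    case True
    then show ?thesis
      unfolding arcs_R P.arcs_exact_dist_graph G.arcs_exact_dist_graph H.arcs_exact_dist_graph
      by (auto simp: graph_dist_strong_prod[OF wf] max_eq_iff pverts_strong_prod)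
  next
    case False
    then show ?thesis
      unfolding arcs_R P.arcs_exact_dist_graph G.arcs_exact_dist_graph H.arcs_exact_dist_graph
      by (auto simp: pverts_strong_prod)
  qed
  then have "parcs ?L = parcs ?R" by auto
  moreover have "pverts ?L = pverts ?R"
    by (auto simp: pverts_Edge_union edge_union_def direct_prod_def exact_dist_graph_def
        pverts_strong_prod)
  ultimately show ?thesis by simp
qed

end
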